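(* For every $p\in[0,1]$, the greedy-based algorithm with parameter $p$ for random-order online weighted matching in general graphs with edge arrivals is order-oblivious $c(p)$-competitive, where $$c(p)=\begin{cases}\dfrac{p^2(1-p)}{2} & \text{if } p\le\frac{\sqrt5-1}{2},\\[2mm] \dfrac{(1-p)(2p-1)}{2p} & \text{otherwise.}\end{cases}$$ That is, for every finite graph $G=(V,E)$ with weights $w:E\to\mathbb{R}_{\ge0}$ and for any arrival order of the edges of $E\setminus E'$ after the sampling phase (possibly adversarial and depending on the sample $E'$), the output matching has expected weight at least $c(p)\cdot\mathrm{OPT}$.
   Context: Setting. An adversary chooses a finite graph $G=(V,E)$ with weights $w:E\to\mathbb{R}_{\ge0}$; ties between weights are broken by a fixed consistent rule, so edge weights are totally ordered. $|E|$ is known upfront. Edges arrive online one by one; when an edge arrives its weight is revealed and the algorithm must irrevocably accept it (keeping accepted edges vertex-disjoint) or reject it. $\mathrm{OPT}$ is the maximum weight of a matching in $G$. For $F\subseteq E$, $G[F]$ is the subgraph with edge set $F$. $\mathrm{Greedy}(K)$: process the edges of $K$ in non-increasing order of weight, adding an edge to the matching iff neither endpoint is already covered. Greedy-based algorithm with parameter $p$: (1) draw $k\sim\mathrm{Binom}(|E|,p)$ and let $E'$ be the first $k$ edges in a uniformly random arrival order of $E$ (sampling phase; equivalently each edge is in $E'$ independently with probability $p$); set $M=\emptyset$. (2) When a later edge $e=(u,v)\in E\setminus E'$ arrives, if $e\in\mathrm{Greedy}(G[E'\cup\{e\}])$ and neither $u$ nor $v$ is matched in $M$, add $e$ to $M$.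 Output $M$. The algorithm is order-oblivious $c$-competitive if its expected output weight is at least $c\cdot\mathrm{OPT}$ on every instance, for any (possibly adversarial) arrival order of $E\setminus E'$ after the sampling phase. *)

theory Defs
  imports "HOL-Probability.Probability" "HOL-Combinatorics.Multiset_Permutations"
begin

definition finite_graph :: "'v set \<Rightarrow> 'v set set \<Rightarrow> bool" where
  "finite_graph V E \<longleftrightarrow> finite V \<and> (\<forall>e\<in>E. e \<subseteq> V \<and> card e = 2)"

definition matching :: "'v set set \<Rightarrow> 'v set set \<Rightarrow> bool" where
  "matching E M \<longleftrightarrow> M \<subseteq> E \<and> disjoint M"

definition OPT :: "'v set set \<Rightarrow> ('v set \<Rightarrow> real) \<Rightarrow> real" where
  "OPT E w = Max {sum w M |M. matching E M}"

definition free :: "'v set set \<Rightarrow> 'v set \<Rightarrow> bool" where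
  "free M e \<longleftrightarrow> e \<inter> \<Union>M = {}"

text \<open>
  Equal weights are ordered by a fixed numbering \<open>tie\<close> of the edges (injective on the edge set):
  \<open>sort_key\<close> is stable, so edges of equal weight stay in the order of increasing \<open>tie\<close>, and the
  order of any two edges does not depend on the edge set \<open>K\<close> being sorted.
\<close>

definition by_weight :: "('v set \<Rightarrow> real) \<Rightarrow> ('v set \<Rightarrow> nat) \<Rightarrow> 'v set set \<Rightarrow> 'v set list" where
  "by_weight w tie K = sort_key (\<lambda>e. - w e) (sorted_key_list_of_set tie K)"

definition greedy :: "('v set \<Rightarrow> real) \<Rightarrow> ('v set \<Rightarrow> nat) \<Rightarrow> 'v set set \<Rightarrow> 'v set set" where
  "greedy w tie K = foldl (\<lambda>M e. if free M e then insert e M else M) {} (by_weight w tie K)"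

definition sample :: "real \<Rightarrow> 'v set set \<Rightarrow> 'v set set pmf" where
  "sample p E =
     do {
       k \<leftarrow> binomial_pmf (card E) p;
       \<sigma> \<leftarrow> pmf_of_set (permutations_of_set E);
       return_pmf (set (take k \<sigma>))
     }"

definition online_phase ::
  "('v set \<Rightarrow> real) \<Rightarrow> ('v set \<Rightarrow> nat) \<Rightarrow> 'v set set \<Rightarrow> 'v set list \<Rightarrow> 'v set set" where
  "online_phase w tie E' es =
     foldl (\<lambda>M e. if e \<in> greedy w tie (insert e E') \<and> free M e then insert e M else M) {} es"

text \<open>
  The arrival order of the unsampled edges is a (possibly randomised) function of the sample.
  A deterministic adversary is the case where every \<open>arr E'\<close> is a point mass; the uniformly
  random arrival order is the case where every \<open>arr E'\<close> is uniform.  A dependence on anything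
  else that is known or drawn in the sampling phase, such as the order within the sample, is covered
  by conditioning on the sample.
\<close>

definition arrival_order ::
  "'v set set \<Rightarrow> ('v set set \<Rightarrow> 'v set list pmf) \<Rightarrow> bool" where
  "arrival_order E arr \<longleftrightarrow> (\<forall>E'\<subseteq>E. set_pmf (arr E') \<subseteq> permutations_of_set (E - E'))"

definition greedy_based ::
  "real \<Rightarrow> 'v set set \<Rightarrow> ('v set \<Rightarrow> real) \<Rightarrow> ('v set \<Rightarrow> nat)
     \<Rightarrow> ('v set set \<Rightarrow> 'v set list pmf) \<Rightarrow> 'v set set pmf" where
  "greedy_based p E w tie arr =
     do {
       E' \<leftarrow> sample p E;
       es \<leftarrow> arr E';
       return_pmf (online_phase w tie E' es)
     }"

definition ratio :: "real \<Rightarrow> real" where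
  "ratio p = (if p \<le> (sqrt 5 - 1) / 2 then p\<^sup>2 * (1 - p) / 2
              else (1 - p) * (2 * p - 1) / (2 * p))"

end

theory Submission
  imports Defs
begin

text \<open>
  Reveal the edges by decreasing weight, deciding independently for each whether it is sampled.  An
  edge is available if both endpoints are still free in the greedy matching of the sample; an
  available edge is matched by greedy if sampled and a candidate otherwise.  Charging the edges of an
  optimal matching to heavier greedy edges shows that the expected weight \<open>Y\<close> of the available edges
  is at least \<open>OPT\<close> if \<open>p \<le> 1/2\<close> and at least \<open>OPT / (2p)\<close> if \<open>p \<ge> 1/2\<close>; the candidates have expected
  weight \<open>c = (1 - p) Y\<close>.

  After a candidate, the next available edge at an endpoint is sampled with probability \<open>p\<close>, so a
  candidate is the last one at \<open>k\<close> of its endpoints with probability at least \<open>p\<^sup>k\<close>, whatever happened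
  before.  Let \<open>D\<close> and \<open>N\<close> be the candidates that are last at both and at no endpoint, and \<open>I\<close> the
  isolated ones.  Any maximal matching \<open>M\<close> of the candidates contains \<open>I\<close>, and an edge of \<open>M\<close>
  blocks a lighter edge of \<open>D\<close> only at an endpoint where it is not last itself, so
  \<open>w(D) \<le> w(M) + w(M \<inter> N)\<close>.  Hence \<open>w(M) \<ge> w(D) - w(N)\<close>, of expectation at least \<open>(2p - 1) c\<close>, and
  \<open>2 w(M) \<ge> w(D) + w(I)\<close>, of expectation at least \<open>p\<^sup>2 c + p\<^sup>2 r\<close>, where the expected weight \<open>r\<close> of
  the candidates that are first at both endpoints is nonnegative and at least \<open>(2p - 1) c\<close>.  This
  gives the three lower bounds \<open>p\<^sup>2 c / 2\<close>, \<open>p\<^sup>3 c\<close> and \<open>(2p - 1) c\<close>, used for \<open>p \<le> 1/2\<close>, for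
  \<open>1/2 < p \<le> (sqrt 5 - 1) / 2\<close> and for larger \<open>p\<close>.
\<close>

subsection \<open>Independent sampling\<close>

text \<open>Expectation of \<open>f\<close> over a random subset of \<open>E\<close> that contains
  each element independently with probability \<open>p\<close>. The finite sum allows induction on
  \<open>E\<close>.\<close>

definition subset_mean :: "real \<Rightarrow> 'a set \<Rightarrow> ('a set \<Rightarrow> real) \<Rightarrow> real" where
  "subset_mean p E f = (\<Sum>A\<in>Pow E. p ^ card A * (1 - p) ^ card (E - A) * f A)"

lemma subset_mean_empty [simp]: "subset_mean p {} f = f {}"
  by (simp add: subset_mean_def)

lemma subset_mean_cong:
  assumes "\<And>A. A \<subseteq> E \<Longrightarrow> f A = g A"
  shows "subset_mean p E f = subset_mean p E g"
  unfolding subset_mean_def by (intro sum.cong) (auto simp: assms)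

lemma subset_mean_mono:
  assumes "0 \<le> p" "p \<le> 1" "\<And>A. A \<subseteq> E \<Longrightarrow> f A \<le> g A"
  shows "subset_mean p E f \<le> subset_mean p E g"
  unfolding subset_mean_def by (intro sum_mono mult_left_mono) (use assms in auto)

lemma subset_mean_add: "subset_mean p E (\<lambda>A. f A + g A) = subset_mean p E f + subset_mean p E g"
  by (simp add: subset_mean_def algebra_simps sum.distrib)

lemma subset_mean_diff: "subset_mean p E (\<lambda>A. f A - g A) = subset_mean p E f - subset_mean p E g"
  by (simp add: subset_mean_def algebra_simps sum_subtractf)

lemma subset_mean_cmult: "subset_mean p E (\<lambda>A. c * f A) = c * subset_mean p E f"
  by (simp add: subset_mean_def sum_distrib_left mult_ac)

lemma subset_mean_sum: "subset_mean p E (\<lambda>A. \<Sum>i\<in>I. f i A) = (\<Sum>i\<in>I. subset_mean p E (f i))"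
  unfolding subset_mean_def by (simp add: sum_distrib_left) (rule sum.swap)

lemma subset_mean_insert:
  assumes "finite E" "x \<notin> E"
  shows "subset_mean p (insert x E) f =
           p * subset_mean p E (\<lambda>A. f (insert x A)) + (1 - p) * subset_mean p E f"
proof -
  have inj: "inj_on (insert x) (Pow E)"
    using assms(2) by (auto simp: inj_on_def)
  have "subset_mean p (insert x E) f =
      (\<Sum>A\<in>Pow E. p ^ card A * (1 - p) ^ card (insert x E - A) * f A) +
      (\<Sum>A\<in>insert x ` Pow E. p ^ card A * (1 - p) ^ card (insert x E - A) * f A)"
    unfolding subset_mean_def Pow_insert
    by (rule sum.union_disjoint) (use assms in auto)
  also have "(\<Sum>A\<in>insert x ` Pow E. p ^ card A * (1 - p) ^ card (insert x E - A) * f A) =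
      (\<Sum>A\<in>Pow E. p * (p ^ card A * (1 - p) ^ card (E - A) * f (insert x A)))"
  proof (subst sum.reindex[OF inj], rule sum.cong, goal_cases)
    case (2 A)
    then have "finite A" "x \<notin> A" "insert x E - insert x A = E - A"
      using assms finite_subset by auto
    then show ?case by simp
  qed simp
  also have "(\<Sum>A\<in>Pow E. p ^ card A * (1 - p) ^ card (insert x E - A) * f A) =
      (\<Sum>A\<in>Pow E. (1 - p) * (p ^ card A * (1 - p) ^ card (E - A) * f A))"
  proof (rule sum.cong, goal_cases)
    case (2 A)
    then have "x \<notin> A" "insert x E - A = insert x (E - A)" "x \<notin> E - A"
      using assms by auto
    then show ?case using assms(1) by simp
  qed simp
  finally show ?thesis
    by (simp add: subset_mean_def sum_distrib_left)
qed

lemma subset_mean_const [simp]: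
  assumes "finite E"
  shows "subset_mean p E (\<lambda>_. c) = c"
  using assms by induction (auto simp: subset_mean_insert algebra_simps)

text \<open>Independence across disjoint sets: sample \<open>X\<close> first, then \<open>Y\<close>.
  This allows heavy edges to be revealed before light ones.\<close>

lemma subset_mean_Un:
  assumes "finite X" "finite Y" "X \<inter> Y = {}"
  shows "subset_mean p (X \<union> Y) f = subset_mean p X (\<lambda>K. subset_mean p Y (\<lambda>B. f (K \<union> B)))"
  using assms(1,3)
proof (induction X arbitrary: f)
  case (insert x X)
  then show ?case
    using assms(2) by (simp add: subset_mean_insert)
qed simp

text \<open>The assumption on \<open>g\<close> says that its value ignores the coin of
  \<open>x\<close>, so this coin factors out.\<close>

lemma subset_mean_indep:
  assumes "finite E" "x \<in> E" "\<And>A. A \<subseteq> E - {x} \<Longrightarrow> g (insert x A) = g A"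
  shows "subset_mean p E (\<lambda>A. of_bool (x \<in> A) * g A) = p * subset_mean p E g"
    and "subset_mean p E (\<lambda>A. of_bool (x \<notin> A) * g A) = (1 - p) * subset_mean p E g"
proof -
  have E: "E = insert x (E - {x})" and fin: "finite (E - {x})"
    using assms by auto
  have mean: "subset_mean p E h = p * subset_mean p (E - {x}) (\<lambda>A. h (insert x A))
      + (1 - p) * subset_mean p (E - {x}) h" for h
    using subset_mean_insert[OF fin, of x p h] E by simp
  have zero: "subset_mean p (E - {x}) (\<lambda>_. 0) = 0"
    using fin by simp
  have ins: "subset_mean p (E - {x}) (\<lambda>A. g (insert x A)) = subset_mean p (E - {x}) g"
    by (rule subset_mean_cong) (use assms in auto)
  have [simp]: "subset_mean p (E - {x}) (\<lambda>A. of_bool (x \<in> A) * g A) = 0"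
    by (subst zero[symmetric], rule subset_mean_cong) auto
  have [simp]: "subset_mean p (E - {x}) (\<lambda>A. of_bool (x \<notin> A) * g A) = subset_mean p (E - {x}) g"
    by (rule subset_mean_cong) auto
  show "subset_mean p E (\<lambda>A. of_bool (x \<in> A) * g A) = p * subset_mean p E g"
    "subset_mean p E (\<lambda>A. of_bool (x \<notin> A) * g A) = (1 - p) * subset_mean p E g"
    unfolding mean using fin by (simp_all add: ins ring_distribs del: mult_eq_0_iff)
qed

section \<open>The law of the sample\<close>

lemma sum_take_permutations_of_set:
  fixes f :: "'a set \<Rightarrow> real"
  assumes "finite E" "k \<le> card E"
  shows "(\<Sum>\<sigma>\<in>permutations_of_set E. f (set (take k \<sigma>))) =
           (\<Sum>A | A \<subseteq> E \<and> card A = k. fact k * fact (card E - k) * f A)"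
proof -
  have "(\<Sum>\<sigma>\<in>permutations_of_set E. f (set (take k \<sigma>))) =
      (\<Sum>(A, xs, ys)\<in>(SIGMA A:{A. A \<subseteq> E \<and> card A = k}.
         permutations_of_set A \<times> permutations_of_set (E - A)). f A)"
  \<comment> \<open>A permutation whose first \<open>k\<close> entries form \<open>A\<close> is an
    ordering of \<open>A\<close> followed by one of \<open>E - A\<close>, so each \<open>A\<close>
    of size \<open>k\<close> arises \<open>fact k * fact (card E - k)\<close> times.\<close>
  proof (rule sum.reindex_bij_witness[where
        j = "\<lambda>\<sigma>. (set (take k \<sigma>), take k \<sigma>, drop k \<sigma>)" and i = "\<lambda>(A, xs, ys). xs @ ys"],
      goal_cases)
    case (2 \<sigma>)
    then have \<sigma>: "set \<sigma> = E" "distinct \<sigma>" by (auto dest: permutations_of_setD)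
    then have "length \<sigma> = card E" by (metis distinct_card)
    then have "card (set (take k \<sigma>)) = k"
      using \<sigma> assms by (simp add: distinct_card)
    moreover have "set (drop k \<sigma>) = E - set (take k \<sigma>)"
      using \<sigma> by (metis append_take_drop_id distinct_append set_append Diff_cancel Un_Diff
          Diff_triv Int_commute Un_empty_left)
    ultimately show ?case
      using \<sigma> by (auto intro!: permutations_of_setI dest: in_set_takeD)
  next
    case (3 t)
    then show ?case
      by (auto simp: permutations_of_set_def distinct_card)
  next
    case (4 t)
    obtain A xs ys where t: "t = (A, xs, ys)" by (cases t)
    with 4 have "A \<subseteq> E" "set xs = A" "distinct xs" "set ys = E - A" "distinct ys"
      by (auto dest: permutations_of_setD)
    then show ?case
      by (auto simp: t intro!: permutations_of_setI)
  qed auto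
  also have "\<dots> = (\<Sum>A | A \<subseteq> E \<and> card A = k.
      \<Sum>(xs, ys)\<in>permutations_of_set A \<times> permutations_of_set (E - A). f A)"
    using assms by (subst sum.Sigma) (auto simp: case_prod_unfold)
  also have "\<dots> = (\<Sum>A | A \<subseteq> E \<and> card A = k. fact k * fact (card E - k) * f A)"
    by (rule sum.cong)
      (use assms in \<open>auto simp: case_prod_unfold card_cartesian_product card_Diff_subset finite_subset\<close>)
  finally show ?thesis .
qed

lemma finite_set_pmf_sample:
  assumes "finite E" "p \<in> {0..1}"
  shows "finite (set_pmf (sample p E))" "set_pmf (sample p E) \<subseteq> Pow E"
proof -
  have "set_pmf (sample p E) \<subseteq> Pow E"
    using assms by (auto simp: sample_def dest!: in_set_takeD dest: permutations_of_setD(1))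
  then show "finite (set_pmf (sample p E))" "set_pmf (sample p E) \<subseteq> Pow E"
    using assms by (auto dest: finite_subset)
qed

text \<open>Given \<open>k\<close>, each \<open>k\<close>-subset is the sample with probability one
  over \<open>card E choose k\<close>; this cancels the coefficient in the binomial law of
  \<open>k\<close>.\<close>

lemma expectation_sample:
  fixes f :: "'v set set \<Rightarrow> real"
  assumes "finite E" "0 \<le> p" "p \<le> 1"
  shows "measure_pmf.expectation (sample p E) f = subset_mean p E f"
proof -
  let ?n = "card E"
  have p: "p \<in> {0..1}" using assms by simp
  have "measure_pmf.expectation (sample p E) f =
      (\<Sum>k\<le>?n. pmf (binomial_pmf ?n p) k *\<^sub>R
        measure_pmf.expectation (pmf_of_set (permutations_of_set E) \<bind>
          (\<lambda>\<sigma>. return_pmf (set (take k \<sigma>)))) f)"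
    unfolding sample_def using assms
    by (intro pmf_expectation_bind) (auto simp: set_pmf_binomial_eq)
  also have "\<dots> = (\<Sum>k\<le>?n. (\<Sum>A\<in>{A \<in> Pow E. card A = k}. p ^ card A * (1 - p) ^ card (E - A) * f A))"
  proof (rule sum.cong, goal_cases)
    case (2 k)
    then have k: "k \<le> ?n" by simp
    have "measure_pmf.expectation (pmf_of_set (permutations_of_set E) \<bind>
          (\<lambda>\<sigma>. return_pmf (set (take k \<sigma>)))) f
        = (\<Sum>\<sigma>\<in>permutations_of_set E. f (set (take k \<sigma>))) / fact ?n"
      using assms(1) by (subst pmf_expectation_bind_pmf_of_set) 
        (auto simp: sum_divide_distrib field_simps)
    also have "\<dots> = (\<Sum>A | A \<subseteq> E \<and> card A = k. fact k * fact (?n - k) * f A) / fact ?n"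
      by (subst sum_take_permutations_of_set[OF assms(1) k]) simp
    finally have *: "measure_pmf.expectation (pmf_of_set (permutations_of_set E) \<bind>
          (\<lambda>\<sigma>. return_pmf (set (take k \<sigma>)))) f = 
          (\<Sum>A | A \<subseteq> E \<and> card A = k. fact k * fact (?n - k) * f A) / fact ?n" .
    have c: "real (?n choose k) * (fact k * fact (?n - k)) / fact ?n = 1"
      using k by (simp add: binomial_fact)
    have "pmf (binomial_pmf ?n p) k * ((\<Sum>A | A \<subseteq> E \<and> card A = k. fact k * fact (?n - k) * f A) / fact ?n)
       = (\<Sum>A | A \<subseteq> E \<and> card A = k. (real (?n choose k) * (fact k * fact (?n - k)) / fact ?n) *
             (p ^ k * (1 - p) ^ (?n - k) * f A))"
      using p by (simp add: sum_divide_distrib sum_distrib_left sum_distrib_right mult_ac)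
    also have "\<dots> = (\<Sum>A\<in>{A \<in> Pow E. card A = k}. p ^ card A * (1 - p) ^ card (E - A) * f A)"
      unfolding c
      by (rule sum.cong) (use assms in \<open>auto simp: card_Diff_subset finite_subset\<close>)
    finally show ?case by (simp add: *)
  qed simp
  also have "\<dots> = subset_mean p E f"
    unfolding subset_mean_def
    by (rule sum.group) (use assms in \<open>auto simp: card_mono\<close>)
  finally show ?thesis .
qed

subsection \<open>The greedy matching\<close>

lemma sum_filter_of_bool:
  fixes f :: "'a \<Rightarrow> real"
  assumes "finite A"
  shows "sum f {x \<in> A. P x} = (\<Sum>x\<in>A. f x * of_bool (P x))"
  using assms by (intro sum.mono_neutral_cong_left) auto

lemma sorted_wrt_less_insort_key:
  assumes "sorted_wrt (\<lambda>x y. f x < f y) xs" "f x \<notin> f ` set xs"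
  shows "sorted_wrt (\<lambda>x y. f x < f y) (insort_key f x xs)"
  using assms by (induction xs) (auto simp: set_insort_key)

text \<open>
  The facts of locale \<^locale>\<open>folding_insort_key\<close> are about its own copy of
  \<^const>\<open>sorted_key_list_of_set\<close>, hence the detour through \<^locale>\<open>folding_on\<close>.
\<close>
lemma sorted_key_list_of_set_inj_on:
  assumes inj: "inj_on f S" and K: "finite K" "K \<subseteq> S"
  shows "set (sorted_key_list_of_set f K) = K"
    and "sorted_wrt (\<lambda>x y. f x < f y) (sorted_key_list_of_set f K)"
proof -
  interpret folding_on S "insort_key f" "[]"
  proof
    fix x y assume "x \<in> S" "y \<in> S"
    then have "insort_key f y (insort_key f x xs) = insort_key f x (insort_key f y xs)" for xs
      using inj by (cases "x = y") (auto intro: insort_key_left_comm dest: inj_onD)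
    then show "insort_key f y \<circ> insort_key f x = insort_key f x \<circ> insort_key f y"
      by (simp add: fun_eq_iff)
  qed
  have "set (F K) = K \<and> sorted_wrt (\<lambda>x y. f x < f y) (F K)"
    using K
  proof (induction K)
    case (insert x K)
    then have "f x \<notin> f ` K" using inj by (auto dest: inj_onD)
    then show ?case
      using insert sorted_wrt_less_insort_key[of f "F K" x]
      by (auto simp: set_insort_key)
  qed simp
  then show "set (sorted_key_list_of_set f K) = K"
    "sorted_wrt (\<lambda>x y. f x < f y) (sorted_key_list_of_set f K)"
    unfolding sorted_key_list_of_set_def by simp_all
qed

section \<open>The order of the edges and the greedy decisions\<close>

locale weighted_edges =
  fixes E :: "'v set set" and w :: "'v set \<Rightarrow> real" and tie :: "'v set \<Rightarrow> nat"
  assumes finite_E: "finite E"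
    and card_edge: "e \<in> E \<Longrightarrow> card e = 2"
    and weight_nonneg: "e \<in> E \<Longrightarrow> 0 \<le> w e"
    and inj_tie: "inj_on tie E"
begin

text \<open>The order in which greedy processes any edge set; injectivity of \<open>tie\<close>
  makes it total on \<open>E\<close>.\<close>

definition prec :: "'v set \<Rightarrow> 'v set \<Rightarrow> bool" (infix "\<lhd>" 50) where
  "e \<lhd> f \<longleftrightarrow> w f < w e \<or> w e = w f \<and> tie e < tie f"

lemma prec_irrefl [simp]: "\<not> e \<lhd> e"
  by (simp add: prec_def)

lemma prec_trans: "e \<lhd> f \<Longrightarrow> f \<lhd> g \<Longrightarrow> e \<lhd> g"
  by (auto simp: prec_def)

lemma prec_asym: "e \<lhd> f \<Longrightarrow> \<not> f \<lhd> e"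
  by (auto simp: prec_def)

lemma prec_total: "e \<in> E \<Longrightarrow> f \<in> E \<Longrightarrow> e \<lhd> f \<or> e = f \<or> f \<lhd> e"
  using inj_tie by (auto simp: prec_def inj_on_def) (metis linorder_less_linear)+

lemma prec_weight: "e \<lhd> f \<Longrightarrow> w f \<le> w e"
  by (auto simp: prec_def)

lemma finite_edge: "e \<in> E \<Longrightarrow> finite e"
  using card_edge by (metis card.infinite zero_neq_numeral)

lemma edge_nonempty: "e \<in> E \<Longrightarrow> e \<noteq> {}"
  using card_edge by fastforce

lemma exists_prec_min:
  assumes "F \<subseteq> E" "F \<noteq> {}"
  obtains e where "e \<in> F" "\<And>f. f \<in> F \<Longrightarrow> \<not> f \<lhd> e"
proof -
  have "finite F" using assms finite_E finite_subset by blast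
  moreover have "asymp_on F (\<lhd>)" "transp_on F (\<lhd>)"
    by (auto simp: asymp_on_def transp_on_def dest: prec_asym intro: prec_trans)
  ultimately show ?thesis
    using Finite_Set.bex_min_element[of F "(\<lhd>)"] assms that prec_asym by metis
qed

text \<open>\<open>sort_key\<close> inserts from the back of the list, so \<open>x\<close> meets
  only edges of larger \<open>tie\<close> and is placed in front of those of equal weight.\<close>

lemma sorted_wrt_insort_key:
  assumes "sorted_wrt (\<lhd>) ys" "\<And>y. y \<in> set ys \<Longrightarrow> tie x < tie y"
  shows "sorted_wrt (\<lhd>) (insort_key (\<lambda>e. - w e) x ys)"
  using assms
proof (induction ys)
  case (Cons y ys)
  show ?case
  proof (cases "- w x \<le> - w y")
    case True
    then have "x \<lhd> y" using Cons.prems by (auto simp: prec_def)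
    then show ?thesis using True Cons.prems by (auto intro: prec_trans)
  next
    case False
    then have "y \<lhd> x" by (auto simp: prec_def)
    then show ?thesis using False Cons by (auto simp: set_insort_key)
  qed
qed simp

lemma sorted_wrt_sort_key:
  assumes "sorted_wrt (\<lambda>e f. tie e < tie f) xs"
  shows "sorted_wrt (\<lhd>) (sort_key (\<lambda>e. - w e) xs)"
  using assms by (induction xs) (auto intro!: sorted_wrt_insort_key)

lemma by_weight:
  assumes "K \<subseteq> E"
  shows "set (by_weight w tie K) = K" "sorted_wrt (\<lhd>) (by_weight w tie K)"
proof -
  have "finite K" using assms finite_E finite_subset by blast
  note sorted = sorted_key_list_of_set_inj_on[OF inj_tie this assms]
  show "set (by_weight w tie K) = K"
    by (simp add: by_weight_def sorted)
  show "sorted_wrt (\<lhd>) (by_weight w tie K)"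
    unfolding by_weight_def by (intro sorted_wrt_sort_key sorted)
qed

text \<open>Membership of \<open>e\<close> in \<open>A\<close> is left out on purpose: the condition
  then makes sense for unsampled edges too and is independent of the coin of
  \<open>e\<close>.\<close>

definition avail :: "'v set set \<Rightarrow> 'v set \<Rightarrow> bool" where
  "avail A e \<longleftrightarrow> (\<forall>f\<in>greedy w tie A. f \<lhd> e \<longrightarrow> f \<inter> e = {})"

text \<open>In a sorted list an edge chosen after \<open>e\<close> follows it in
  \<open>\<lhd>\<close>, so whether \<open>e\<close> was free when processed can be read off the
  final matching.\<close>

lemma mem_foldl_greedy:
  assumes "sorted_wrt (\<lhd>) xs"
  defines "G \<equiv> \<lambda>xs. foldl (\<lambda>M e. if free M e then insert e M else M) {} xs"
  shows "e \<in> G xs \<longleftrightarrow> e \<in> set xs \<and> (\<forall>f\<in>G xs. f \<lhd> e \<longrightarrow> f \<inter> e = {})"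
  using assms(1)
proof (induction xs arbitrary: e rule: rev_induct)
  case Nil
  then show ?case by (simp add: G_def)
next
  case (snoc x xs)
  have "sorted_wrt (\<lhd>) xs" and before: "\<And>f. f \<in> set xs \<Longrightarrow> f \<lhd> x"
    using snoc.prems by (auto simp: sorted_wrt_append)
  note IH = snoc.IH[OF this(1)]
  have sub: "G xs \<subseteq> set xs" using IH by blast
  have step: "G (xs @ [x]) = (if free (G xs) x then insert x (G xs) else G xs)"
    by (simp add: G_def)
  have free: "free (G xs) x \<longleftrightarrow> (\<forall>f\<in>G xs. f \<lhd> x \<longrightarrow> f \<inter> x = {})"
    using sub before by (auto simp: free_def)
  show ?case
  proof (cases "e = x")
    case True
    have "x \<notin> G xs" using sub before prec_irrefl by blast
    then show ?thesis using True free by (auto simp: step)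
  next
    case False
    then have "e \<in> G (xs @ [x]) \<longleftrightarrow> e \<in> G xs" by (simp add: step)
    also have "\<dots> \<longleftrightarrow> e \<in> set xs \<and> (\<forall>f\<in>G xs. f \<lhd> e \<longrightarrow> f \<inter> e = {})" by (rule IH)
    also have "\<dots> \<longleftrightarrow> e \<in> set xs \<and> (\<forall>f\<in>G (xs @ [x]). f \<lhd> e \<longrightarrow> f \<inter> e = {})"
      using before by (auto simp: step dest: prec_asym)
    finally show ?thesis using False by simp
  qed
qed

lemma mem_greedy:
  assumes "A \<subseteq> E"
  shows "e \<in> greedy w tie A \<longleftrightarrow> e \<in> A \<and> avail A e"
  unfolding avail_def greedy_def
  using mem_foldl_greedy[OF by_weight(2)[OF assms], of e] unfolding by_weight(1)[OF assms] .

lemma greedy_subset: "A \<subseteq> E \<Longrightarrow> greedy w tie A \<subseteq> A"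
  by (auto simp: mem_greedy)

text \<open>Greedy settles edges in order, so availability of \<open>e\<close> depends only on the
  coins of its predecessors. The induction is on their number.\<close>

lemma avail_cong:
  assumes "A \<subseteq> E" "B \<subseteq> E" "\<And>f. f \<in> E \<Longrightarrow> f \<lhd> e \<Longrightarrow> f \<in> A \<longleftrightarrow> f \<in> B"
  shows "avail A e \<longleftrightarrow> avail B e"
  using assms(3)
proof (induction "card {f \<in> E. f \<lhd> e}" arbitrary: e rule: less_induct)
  case less
  have "f \<in> greedy w tie A \<longleftrightarrow> f \<in> greedy w tie B" if f: "f \<in> E" "f \<lhd> e" for f
  proof -
    have "{g \<in> E. g \<lhd> f} \<subset> {g \<in> E. g \<lhd> e}"
      using f prec_trans prec_irrefl by blast
    then have "card {g \<in> E. g \<lhd> f} < card {g \<in> E. g \<lhd> e}"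
      using finite_E by (intro psubset_card_mono) auto
    then have "avail A f \<longleftrightarrow> avail B f"
      using less f prec_trans by blast
    then show ?thesis
      using less.prems f assms by (auto simp: mem_greedy)
  qed
  moreover have "greedy w tie A \<subseteq> E" "greedy w tie B \<subseteq> E"
    using greedy_subset assms by blast+
  ultimately show ?case
    unfolding avail_def by blast
qed

lemma mem_greedy_insert:
  assumes "A \<subseteq> E" "e \<in> E"
  shows "e \<in> greedy w tie (insert e A) \<longleftrightarrow> avail A e"
proof -
  have "avail (insert e A) e \<longleftrightarrow> avail A e"
    using assms by (intro avail_cong) auto
  then show ?thesis using assms by (simp add: mem_greedy)
qed

lemma greedy_insert_later:
  assumes "K \<subseteq> E" "y \<in> E" "\<And>k. k \<in> K \<Longrightarrow> k \<lhd> y"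
  shows "greedy w tie (insert y K) =
    (if avail K y then insert y (greedy w tie K) else greedy w tie K)"
proof (rule set_eqI)
  fix e
  have "y \<notin> K" using assms(3) prec_irrefl by blast
  have "avail (insert y K) e \<longleftrightarrow> avail K e" if "e \<in> insert y K"
    using that assms by (intro avail_cong) (auto dest: prec_asym)
  then show "e \<in> greedy w tie (insert y K) \<longleftrightarrow>
      e \<in> (if avail K y then insert y (greedy w tie K) else greedy w tie K)"
    using assms(1,2) \<open>y \<notin> K\<close> by (auto simp: mem_greedy)
qed

subsection \<open>Maximal matchings of the candidates\<close>

text \<open>The unsampled edges that pass the greedy test of the algorithm. The set depends on the
  sample alone, never on the arrival order.\<close>

definition candidates :: "'v set set \<Rightarrow> 'v set set" where
  "candidates A = {e \<in> E - A. avail A e}"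

text \<open>A set of endpoints rather than a predicate, so that its cardinality can be averaged; the
  values \<open>e\<close> and \<open>{}\<close> mark the classes \<open>D\<close> and
  \<open>N\<close>.\<close>

definition lasts :: "'v set set \<Rightarrow> 'v set \<Rightarrow> 'v set" where
  "lasts C e = {u \<in> e. \<forall>g\<in>C. e \<lhd> g \<longrightarrow> u \<notin> g}"

definition firsts :: "'v set set \<Rightarrow> 'v set \<Rightarrow> 'v set" where
  "firsts C e = {u \<in> e. \<forall>g\<in>C. g \<lhd> e \<longrightarrow> u \<notin> g}"

definition maximal_matching :: "'v set set \<Rightarrow> 'v set set \<Rightarrow> bool" where
  "maximal_matching C M \<longleftrightarrow> M \<subseteq> C \<and> disjoint M \<and> (\<forall>e\<in>C. \<exists>f\<in>M. e \<inter> f \<noteq> {})"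

lemma foldl_greedy_maximal:
  assumes "\<And>e. e \<in> set es \<Longrightarrow> e \<noteq> {}"
  shows "maximal_matching {e \<in> set es. P e}
    (foldl (\<lambda>M e. if P e \<and> free M e then insert e M else M) {} es)"
  using assms
proof (induction es rule: rev_induct)
  case Nil
  then show ?case by (simp add: maximal_matching_def)
next
  case (snoc x es)
  let ?M = "foldl (\<lambda>M e. if P e \<and> free M e then insert e M else M) {} es"
  have M: "maximal_matching {e \<in> set es. P e} ?M" using snoc by simp
  have "x \<noteq> {}" using snoc by simp
  show ?case
  proof (cases "P x \<and> free ?M x")
    case True
    then have "\<And>f. f \<in> ?M \<Longrightarrow> x \<inter> f = {}" by (auto simp: free_def)
    then have "disjoint (insert x ?M)"
      using M by (auto simp: maximal_matching_def disjoint_def Int_commute)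
    then show ?thesis
      using M True \<open>x \<noteq> {}\<close> by (auto simp: maximal_matching_def)
  next
    case False
    then have "P x \<Longrightarrow> \<exists>f\<in>?M. x \<inter> f \<noteq> {}" by (auto simp: free_def)
    then show ?thesis
      using M False by (auto simp: maximal_matching_def)
  qed
qed

text \<open>The greedy test looks at the sample only, so the online phase serves a fixed set of
  candidates first come, first served. Every arrival order is covered by this.\<close>

lemma online_phase_maximal:
  assumes "A \<subseteq> E" "es \<in> permutations_of_set (E - A)"
  shows "maximal_matching (candidates A) (online_phase w tie A es)"
proof -
  have es: "set es = E - A" using assms(2) by (rule permutations_of_setD)
  then have "{e \<in> set es. e \<in> greedy w tie (insert e A)} = candidates A"
    using mem_greedy_insert[OF assms(1)] by (auto simp: candidates_def)
  then show ?thesis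
    unfolding online_phase_def
    using foldl_greedy_maximal[of es "\<lambda>e. e \<in> greedy w tie (insert e A)"] es edge_nonempty
    by simp
qed

section \<open>Charging between edges that share a vertex\<close>

lemma lasts_unique:
  assumes "C \<subseteq> E" "e \<in> C" "f \<in> C" "u \<in> lasts C e" "u \<in> lasts C f"
  shows "e = f"
  using assms prec_total[of e f] by (auto simp: lasts_def)

lemma lasts_weight:
  assumes "C \<subseteq> E" "d \<in> C" "f \<in> C" "u \<in> lasts C d" "u \<in> f"
  shows "w d \<le> w f"
  using assms prec_total[of d f] prec_weight[of f d] by (auto simp: lasts_def)

text \<open>An edge \<open>d\<close> that is last at both endpoints and not in \<open>M\<close>
  shares a vertex \<open>u\<close> with some \<open>f\<close> in \<open>M\<close>. Being last at
  \<open>u\<close>, \<open>d\<close> is no heavier than \<open>f\<close>, and \<open>f\<close> is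
  not last at \<open>u\<close>. So \<open>f\<close> pays at most once for each endpoint at which it
  is not last.\<close>

lemma sum_lasts_le:
  assumes "C \<subseteq> E" "maximal_matching C M"
  shows "sum w {e \<in> C. lasts C e = e} \<le> sum w M + sum w {e \<in> M. lasts C e = {}}"
proof -
  define D where "D = {e \<in> C. lasts C e = e}"
  have M: "M \<subseteq> C" "\<And>e. e \<in> C \<Longrightarrow> \<exists>f\<in>M. e \<inter> f \<noteq> {}"
    using assms by (auto simp: maximal_matching_def)
  have fin: "finite C" "finite M" "finite D"
    using assms M finite_E by (auto simp: D_def intro: finite_subset)
  have DE: "D \<subseteq> C" by (auto simp: D_def)
  have fine: "finite f" if "f \<in> M" for f
    using that M assms finite_edge by blast
  \<comment> \<open>The charge of \<open>d\<close> is the pair \<open>(f, u)\<close>;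
    \<open>i\<close> finds \<open>d\<close> again as the only member of \<open>D\<close> at
    \<open>u\<close>.\<close>
  have "sum w (D - M) \<le> (\<Sum>(f, u)\<in>(SIGMA f:M. f - lasts C f). w f)"
  proof (rule sum_le_included[where i = "\<lambda>(f, u). THE d. d \<in> D \<and> u \<in> d"])
    show "\<forall>d\<in>D - M. \<exists>y\<in>(SIGMA f:M. f - lasts C f).
        (case y of (f, u) \<Rightarrow> THE d. d \<in> D \<and> u \<in> d) = d \<and> w d \<le> (case y of (f, u) \<Rightarrow> w f)"
    proof
      fix d assume d: "d \<in> D - M"
      then obtain f u where f: "f \<in> M" "u \<in> d" "u \<in> f" using M DE by blast
      have ud: "u \<in> lasts C d" using d f by (auto simp: D_def)
      have "(THE d. d \<in> D \<and> u \<in> d) = d"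
      proof (rule the_equality)
        fix d' assume "d' \<in> D \<and> u \<in> d'"
        then show "d' = d"
          using d f lasts_unique[OF assms(1), of d' d u] by (auto simp: D_def)
      qed (use d f in auto)
      moreover have "u \<notin> lasts C f"
        using lasts_unique[OF assms(1), of d f u] ud d f M DE by auto
      moreover have "w d \<le> w f"
        using lasts_weight[OF assms(1), of d f u] ud d f M DE by auto
      ultimately show "\<exists>y\<in>(SIGMA f:M. f - lasts C f).
        (case y of (f, u) \<Rightarrow> THE d. d \<in> D \<and> u \<in> d) = d \<and> w d \<le> (case y of (f, u) \<Rightarrow> w f)"
        using f by (intro bexI[of _ "(f, u)"]) auto
    qed
  qed (use fin fine M assms weight_nonneg in \<open>auto intro!: finite_SigmaI\<close>)
  also have "\<dots> = (\<Sum>f\<in>M. real (card (f - lasts C f)) * w f)"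
    using fin fine by (subst sum.Sigma[symmetric]) auto
  finally have le: "sum w (D - M) \<le> (\<Sum>f\<in>M. real (card (f - lasts C f)) * w f)" .
  have "sum w D = sum w (D \<inter> M) + sum w (D - M)"
    using fin by (subst sum.union_disjoint[symmetric]) (auto intro: sum.cong)
  also have "sum w (D \<inter> M) = (\<Sum>f\<in>M. of_bool (lasts C f = f) * w f)"
    using fin M by (intro sum.mono_neutral_cong_left) (auto simp: D_def)
  also note le
  also have "(\<Sum>f\<in>M. of_bool (lasts C f = f) * w f) + (\<Sum>f\<in>M. real (card (f - lasts C f)) * w f)
      \<le> (\<Sum>f\<in>M. w f + w f * of_bool (lasts C f = {}))"
    unfolding sum.distrib[symmetric]
  proof (rule sum_mono)
    fix f assume f: "f \<in> M"
    then have fE: "f \<in> E" using M assms by auto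
    \<comment> \<open>An edge of \<open>M\<close> counts once for itself if it is in
      \<open>D\<close>, plus once for each endpoint at which it is not last: 1 in \<open>D\<close>,
      2 if nowhere last, 1 otherwise.\<close>
    have "of_bool (lasts C f = f) + real (card (f - lasts C f)) \<le> 1 + of_bool (lasts C f = {})"
    proof -
      consider "lasts C f = f" | "lasts C f = {}" | "lasts C f \<noteq> f" "lasts C f \<noteq> {}" by blast
      then show ?thesis
      proof cases
        case 3
        have "lasts C f \<subseteq> f" by (auto simp: lasts_def)
        then have "f - lasts C f \<subset> f" using 3 by auto
        then have "card (f - lasts C f) < card f"
          using finite_edge[OF fE] by (rule psubset_card_mono[rotated])
        then show ?thesis using 3 card_edge[OF fE] by simp
      qed (use card_edge[OF fE] edge_nonempty[OF fE] in auto)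
    qed
    then have "(of_bool (lasts C f = f) + real (card (f - lasts C f))) * w f
        \<le> (1 + of_bool (lasts C f = {})) * w f"
      using weight_nonneg[OF fE] by (rule mult_right_mono)
    then show "of_bool (lasts C f = f) * w f + real (card (f - lasts C f)) * w f
        \<le> w f + w f * of_bool (lasts C f = {})"
      by (simp add: algebra_simps)
  qed
  also have "\<dots> = sum w M + sum w {e \<in> M. lasts C e = {}}"
    using fin by (simp add: sum.distrib sum_filter_of_bool)
  finally show ?thesis by (simp add: D_def)
qed

text \<open>By maximality \<open>M\<close> meets such an edge, and the only candidate that meets it
  is the edge itself.\<close>

lemma isolated_subset_matching:
  assumes "C \<subseteq> E" "maximal_matching C M"
  shows "{e \<in> C. firsts C e = e \<and> lasts C e = e} \<subseteq> M"
proof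
  fix e assume e: "e \<in> {e \<in> C. firsts C e = e \<and> lasts C e = e}"
  then obtain f u where f: "f \<in> M" "u \<in> e" "u \<in> f" and "f \<in> C"
    using assms unfolding maximal_matching_def by blast
  then have "\<not> f \<lhd> e" "\<not> e \<lhd> f"
    using e by (auto simp: firsts_def lasts_def set_eq_iff)
  then show "e \<in> M"
    using prec_total[of e f] f e \<open>f \<in> C\<close> assms by auto
qed

text \<open>The edges of \<open>M\<close> that are nowhere last and the isolated edges are disjoint
  parts of \<open>M\<close>, so in \<open>sum_lasts_le\<close> the former weigh at most
  \<open>sum w M\<close> minus the weight of the latter.\<close>

lemma sum_isolated_le:
  assumes "C \<subseteq> E" "maximal_matching C M"
  shows "sum w {e \<in> C. lasts C e = e} + sum w {e \<in> C. firsts C e = e \<and> lasts C e = e} \<le> 2 * sum w M"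
proof -
  let ?N = "{e \<in> M. lasts C e = {}}" and ?I = "{e \<in> C. firsts C e = e \<and> lasts C e = e}"
  have M: "M \<subseteq> C" using assms by (auto simp: maximal_matching_def)
  have fin: "finite M" using M assms finite_E by (meson finite_subset)
  have "?N \<inter> ?I = {}" using edge_nonempty assms by auto
  then have "sum w ?N + sum w ?I = sum w (?N \<union> ?I)"
    using fin isolated_subset_matching[OF assms]
    by (intro sum.union_disjoint[symmetric]) (auto intro: finite_subset)
  also have "\<dots> \<le> sum w M"
    using fin isolated_subset_matching[OF assms] M assms weight_nonneg
    by (intro sum_mono2) auto
  finally show ?thesis using sum_lasts_le[OF assms] by simp
qed

text \<open>The cardinality is 0, 1 or 2. This rewrites the weight of \<open>D\<close> minus that of
  \<open>N\<close> as a sum over endpoints, whose mean can be bounded one endpoint at a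
  time.\<close>

lemma card_lasts_bound:
  assumes "e \<in> E"
  shows "real (card (lasts C e)) - 1 = of_bool (lasts C e = e) - of_bool (lasts C e = {})"
proof -
  have sub: "lasts C e \<subseteq> e" by (auto simp: lasts_def)
  consider "lasts C e = e" | "lasts C e = {}" | "lasts C e \<noteq> e" "lasts C e \<noteq> {}" by blast
  then show ?thesis
  proof cases
    case 3
    then have "card (lasts C e) < card e"
      using finite_edge[OF assms] sub by (intro psubset_card_mono) auto
    moreover have "0 < card (lasts C e)"
      using 3 finite_subset[OF sub finite_edge[OF assms]] by (simp add: card_gt_0_iff)
    ultimately show ?thesis using 3 card_edge[OF assms] by simp
  qed (use card_edge[OF assms] edge_nonempty[OF assms] in auto)
qed

lemma sum_card_lasts_le_matching:
  assumes "C \<subseteq> E" "maximal_matching C M"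
  shows "(\<Sum>e\<in>C. w e * (real (card (lasts C e)) - 1)) \<le> sum w M"
proof -
  have fin: "finite C" using assms finite_E finite_subset by blast
  have M: "M \<subseteq> C" using assms by (auto simp: maximal_matching_def)
  have "(\<Sum>e\<in>C. w e * (real (card (lasts C e)) - 1)) =
      (\<Sum>e\<in>C. w e * of_bool (lasts C e = e) - w e * of_bool (lasts C e = {}))"
    using card_lasts_bound assms by (intro sum.cong) (auto simp: subset_iff right_diff_distrib)
  also have "\<dots> = sum w {e \<in> C. lasts C e = e} - sum w {e \<in> C. lasts C e = {}}"
    using fin by (simp add: sum_subtractf sum_filter_of_bool)
  also have "\<dots> \<le> sum w {e \<in> C. lasts C e = e} - sum w {e \<in> M. lasts C e = {}}"
    using fin M assms weight_nonneg by (intro diff_left_mono sum_mono2) auto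
  also have "\<dots> \<le> sum w M"
    using sum_lasts_le[OF assms] by simp
  finally show ?thesis .
qed

lemma sum_lasts_le_firsts:
  assumes "C \<subseteq> E"
  shows "(\<Sum>e\<in>C. w e * real (card (lasts C e))) \<le> (\<Sum>e\<in>C. w e * real (card (firsts C e)))"
proof -
  have fin: "finite C" using assms finite_E finite_subset by blast
  have fine: "finite (lasts C e)" "finite (firsts C e)" if "e \<in> C" for e
    using that assms finite_edge by (auto simp: lasts_def firsts_def)
  have "(\<Sum>(e, u)\<in>(SIGMA e:C. lasts C e). w e) \<le> (\<Sum>(f, u)\<in>(SIGMA f:C. firsts C f). w f)"
  \<comment> \<open>A pair \<open>(e, u)\<close> is charged to \<open>(f, u)\<close> for the first
    candidate \<open>f\<close> at \<open>u\<close>. The vertex is kept and determines its last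
    candidate, so no pair is charged twice.\<close>
  proof (rule sum_le_included[where i = "\<lambda>(f, u). (THE e. e \<in> C \<and> u \<in> lasts C e, u)"])
    show "\<forall>x\<in>(SIGMA e:C. lasts C e). \<exists>y\<in>(SIGMA f:C. firsts C f).
        (case y of (f, u) \<Rightarrow> (THE e. e \<in> C \<and> u \<in> lasts C e, u)) = x \<and>
        (case x of (e, u) \<Rightarrow> w e) \<le> (case y of (f, u) \<Rightarrow> w f)"
    proof clarify
      fix e u assume e: "e \<in> C" "u \<in> lasts C e"
      then have "u \<in> e" by (auto simp: lasts_def)
      then have "{f \<in> C. u \<in> f} \<subseteq> E" "{f \<in> C. u \<in> f} \<noteq> {}"
        using assms e by auto
      then obtain f where f: "f \<in> {f \<in> C. u \<in> f}" "\<And>g. g \<in> {f \<in> C. u \<in> f} \<Longrightarrow> \<not> g \<lhd> f"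
        by (rule exists_prec_min) blast
      have "(THE e. e \<in> C \<and> u \<in> lasts C e) = e"
        using e by (intro the_equality lasts_unique[OF assms]) auto
      moreover have "u \<in> firsts C f" "w e \<le> w f"
        using f lasts_weight[OF assms, of e f u] e by (auto simp: firsts_def)
      ultimately show "\<exists>y\<in>(SIGMA f:C. firsts C f).
        (case y of (f, u) \<Rightarrow> (THE e. e \<in> C \<and> u \<in> lasts C e, u)) = (e, u) \<and>
        w e \<le> (case y of (f, u) \<Rightarrow> w f)"
        using f by (intro bexI[of _ "(f, u)"]) auto
    qed
  qed (use fin fine assms weight_nonneg in \<open>auto intro!: finite_SigmaI\<close>)
  then show ?thesis
    using fin fine by (simp add: sum.Sigma[symmetric] mult.commute)
qed

text \<open>
  The sum counts endpoints at which a candidate is last; every vertex has one last and one first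
  candidate, and the latter is at least as heavy.
\<close>
lemma sum_card_lasts_le_roots:
  assumes "C \<subseteq> E"
  shows "(\<Sum>e\<in>C. w e * (real (card (lasts C e)) - 1)) \<le> sum w {e \<in> C. firsts C e = e}"
proof -
  have fin: "finite C" using assms finite_E finite_subset by blast
  have "(\<Sum>e\<in>C. w e * (real (card (lasts C e)) - 1)) \<le> (\<Sum>e\<in>C. w e * (real (card (firsts C e)) - 1))"
    using sum_lasts_le_firsts[OF assms] by (simp add: right_diff_distrib sum_subtractf)
  also have "\<dots> \<le> (\<Sum>e\<in>C. w e * of_bool (firsts C e = e))"
  proof (intro sum_mono mult_left_mono)
    fix e assume "e \<in> C"
    then have e: "e \<in> E" using assms by auto
    then show "0 \<le> w e" by (rule weight_nonneg)
    have sub: "firsts C e \<subseteq> e" by (auto simp: firsts_def)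
    show "real (card (firsts C e)) - 1 \<le> of_bool (firsts C e = e)"
    proof (cases "firsts C e = e")
      case False
      then have "card (firsts C e) < card e"
        using finite_edge[OF e] sub by (intro psubset_card_mono) auto
      then show ?thesis using card_edge[OF e] False by simp
    qed (use card_edge[OF e] in auto)
  qed
  also have "\<dots> = sum w {e \<in> C. firsts C e = e}"
    using fin by (simp add: sum_filter_of_bool)
  finally show ?thesis .
qed

text \<open>
  Greedy edges in \<open>L\<close> are not charged, since \<open>L\<close> is a matching. Without this saving the bound would
  lose a factor \<open>2\<close> for small \<open>p\<close>.
\<close>
lemma matching_le_greedy:
  assumes "A \<subseteq> E" "matching E L"
  shows "sum w L \<le> (\<Sum>e\<in>L. w e * of_bool (avail A e)) + 2 * sum w (greedy w tie A - L)"
proof -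
  have L: "L \<subseteq> E" "disjoint L" using assms by (auto simp: matching_def)
  have GE: "greedy w tie A \<subseteq> E" using greedy_subset[OF assms(1)] assms(1) by blast
  have fin: "finite L" "finite (greedy w tie A)"
    using L GE finite_E by (auto intro: finite_subset)
  have "sum w {e \<in> L. \<not> avail A e} \<le> (\<Sum>(f, u)\<in>(SIGMA f:greedy w tie A - L. f). w f)"
  proof (rule sum_le_included[where i = "\<lambda>(f, u). THE e. e \<in> L \<and> u \<in> e"])
    show "\<forall>e\<in>{e \<in> L. \<not> avail A e}. \<exists>y\<in>(SIGMA f:greedy w tie A - L. f).
        (case y of (f, u) \<Rightarrow> THE e. e \<in> L \<and> u \<in> e) = e \<and> w e \<le> (case y of (f, u) \<Rightarrow> w f)"
    proof
      fix e assume e: "e \<in> {e \<in> L. \<not> avail A e}"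
      then obtain f u where f: "f \<in> greedy w tie A" "f \<lhd> e" "u \<in> f" "u \<in> e"
        unfolding avail_def by blast
      have unique: "e' = e" if "e' \<in> L" "u \<in> e'" for e'
        using disjointD[OF L(2), of e' e] that e f by auto
      then have "f \<notin> L" using f prec_irrefl by metis
      moreover have "(THE e. e \<in> L \<and> u \<in> e) = e"
        using unique e f by (intro the_equality) auto
      ultimately show "\<exists>y\<in>(SIGMA f:greedy w tie A - L. f).
        (case y of (f, u) \<Rightarrow> THE e. e \<in> L \<and> u \<in> e) = e \<and> w e \<le> (case y of (f, u) \<Rightarrow> w f)"
        using f prec_weight by (intro bexI[of _ "(f, u)"]) auto
    qed
  qed (use fin GE weight_nonneg finite_edge in \<open>auto intro!: finite_SigmaI\<close>)
  also have "\<dots> = 2 * sum w (greedy w tie A - L)"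
    using fin GE finite_edge card_edge
    by (subst sum.Sigma[symmetric]) (auto simp: sum_distrib_left intro!: sum.cong)
  finally have "sum w {e \<in> L. \<not> avail A e} \<le> 2 * sum w (greedy w tie A - L)" .
  moreover have "sum w L = sum w {e \<in> L. avail A e} + sum w {e \<in> L. \<not> avail A e}"
    using fin by (subst sum.union_disjoint[symmetric]) (auto intro: sum.cong)
  moreover have "sum w {e \<in> L. avail A e} = (\<Sum>e\<in>L. w e * of_bool (avail A e))"
    using fin by (simp add: sum_filter_of_bool)
  ultimately show ?thesis by simp
qed

subsection \<open>Candidates that are last at their endpoints\<close>

text \<open>
  The exponent drops when an available edge that meets \<open>S\<close> is sampled, and stays put when an edge is
  irrelevant for \<open>S\<close>; an unsampled relevant edge contributes \<open>0\<close>.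
\<close>
lemma mean_no_later_candidate:
  assumes "0 \<le> p" "p \<le> 1" "finite S" "sorted_wrt (\<lhd>) ys" "set ys \<subseteq> E" "K \<subseteq> E"
    and "\<And>k y. k \<in> K \<Longrightarrow> y \<in> set ys \<Longrightarrow> k \<lhd> y"
  shows "p ^ card (S - \<Union>(greedy w tie K)) \<le>
    subset_mean p (set ys) (\<lambda>B. of_bool (\<forall>g\<in>set ys - B. avail (K \<union> B) g \<longrightarrow> g \<inter> S = {}))"
  using assms(4-)
proof (induction ys arbitrary: K)
  case Nil
  then show ?case using assms by (simp add: power_le_one)
next
  case (Cons y ys)
  let ?f = "\<lambda>K B. of_bool (\<forall>g\<in>set ys - B. avail (K \<union> B) g \<longrightarrow> g \<inter> S = {}) :: real"
  let ?F = "\<lambda>B. of_bool (\<forall>g\<in>set (y # ys) - B. avail (K \<union> B) g \<longrightarrow> g \<inter> S = {}) :: real"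
  let ?U = "\<lambda>K. S - \<Union>(greedy w tie K)"
  have y: "y \<notin> set ys" "y \<in> E" "set ys \<subseteq> E" "\<And>k. k \<in> K \<Longrightarrow> k \<lhd> y"
    using Cons.prems by auto
  have later: "\<And>f. f \<in> set ys \<Longrightarrow> y \<lhd> f" using Cons.prems by auto
  have IH1: "p ^ card (?U (insert y K)) \<le> subset_mean p (set ys) (?f (insert y K))"
    using Cons.prems by (intro Cons.IH) auto
  have IH0: "p ^ card (?U K) \<le> subset_mean p (set ys) (?f K)"
    using Cons.prems by (intro Cons.IH) auto
  have eq1: "subset_mean p (set ys) (\<lambda>B. ?F (insert y B)) = subset_mean p (set ys) (?f (insert y K))"
    by (rule subset_mean_cong) (use y in auto)
  have mean: "subset_mean p (set (y # ys)) ?F =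
      p * subset_mean p (set ys) (?f (insert y K)) + (1 - p) * subset_mean p (set ys) ?F"
    using subset_mean_insert[of "set ys" y p ?F] y eq1 by simp
  have greedy: "greedy w tie (insert y K) =
      (if avail K y then insert y (greedy w tie K) else greedy w tie K)"
    using Cons.prems y by (intro greedy_insert_later) auto
  have avail: "avail (K \<union> B) y \<longleftrightarrow> avail K y" if "B \<subseteq> set ys" for B
    using that Cons.prems by (intro avail_cong) (auto dest: later prec_asym subsetD[OF that])
  have sub: "?U (insert y K) \<subseteq> ?U K"
    unfolding greedy by auto
  have fin: "finite (?U K)" using assms by simp
  show ?case
  proof (cases "avail K y \<and> y \<inter> S \<noteq> {}")
    case True
    then obtain u where u: "u \<in> y" "u \<in> S" by auto
    have "u \<notin> f" if "f \<in> greedy w tie K" for f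
      using that True u y(4) greedy_subset[OF Cons.prems(3)] by (auto simp: avail_def)
    then have "?U (insert y K) \<subset> ?U K"
      using sub u True unfolding greedy by auto
    then have "Suc (card (?U (insert y K))) \<le> card (?U K)"
      using fin psubset_card_mono by (metis Suc_leI)
    then have "p ^ card (?U K) \<le> p ^ Suc (card (?U (insert y K)))"
      using assms by (intro power_decreasing) auto
    also have "\<dots> \<le> p * subset_mean p (set ys) (?f (insert y K))"
      using IH1 assms by (simp add: mult_left_mono)
    also have "\<dots> \<le> subset_mean p (set (y # ys)) ?F"
    proof -
      have "subset_mean p (set ys) (\<lambda>_. 0) \<le> subset_mean p (set ys) ?F"
        by (rule subset_mean_mono) (use assms in auto)
      then show ?thesis using assms unfolding mean by simp
    qed
    finally show ?thesis .
  next
    case False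
    have eq0: "subset_mean p (set ys) ?F = subset_mean p (set ys) (?f K)"
    proof (rule subset_mean_cong)
      fix B assume B: "B \<subseteq> set ys"
      then have "y \<notin> B" using y by auto
      then show "?F B = ?f K B" using False avail[OF B] by auto
    qed
    have "p ^ card (?U K) \<le> p ^ card (?U (insert y K))"
      using assms card_mono[OF fin sub] by (intro power_decreasing) auto
    then have "p * p ^ card (?U K) \<le> p * subset_mean p (set ys) (?f (insert y K))"
      using IH1 assms by (intro mult_left_mono) auto
    moreover have "(1 - p) * p ^ card (?U K) \<le> (1 - p) * subset_mean p (set ys) (?f K)"
      using IH0 assms by (intro mult_left_mono) auto
    ultimately show ?thesis unfolding mean eq0 by (simp add: algebra_simps)
  qed
qed

lemma candidates_cong:
  assumes "A \<subseteq> E" "B \<subseteq> E" "\<And>f. f \<in> E \<Longrightarrow> f \<lhd> e \<Longrightarrow> f \<in> A \<longleftrightarrow> f \<in> B" "e \<in> A \<longleftrightarrow> e \<in> B"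
  shows "e \<in> candidates A \<longleftrightarrow> e \<in> candidates B"
  using avail_cong[OF assms(1-3)] assms(4) by (auto simp: candidates_def)

text \<open>First reveal \<open>e\<close> and its predecessors, which settle the candidacy of
  \<open>e\<close> and, by the assumption on \<open>Q\<close>, also \<open>Q\<close>; then
  \<open>mean_no_later_candidate\<close> bounds the conditional probability over the lighter edges.
  \<open>S\<close> will be \<open>e\<close> or a single endpoint, \<open>Q\<close> trivial or being
  first at both endpoints.\<close>

lemma candidate_without_later:
  assumes p: "0 \<le> p" "p \<le> 1" and e: "e \<in> E" and S: "finite S"
    and Q: "\<And>A. A \<subseteq> E \<Longrightarrow> Q A \<longleftrightarrow> Q {f \<in> A. f = e \<or> f \<lhd> e}"
  shows "p ^ card S * subset_mean p E (\<lambda>A. of_bool (e \<in> candidates A \<and> Q A)) \<le>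
    subset_mean p E (\<lambda>A. of_bool (e \<in> candidates A \<and> Q A \<and>
      (\<forall>g\<in>candidates A. e \<lhd> g \<longrightarrow> g \<inter> S = {})))"
proof -
  define X where "X = {f \<in> E. f = e \<or> f \<lhd> e}"
  define Y where "Y = {f \<in> E. e \<lhd> f}"
  have XY: "E = X \<union> Y" "X \<inter> Y = {}" "finite X" "finite Y" "Y \<subseteq> E"
    using prec_total e finite_E by (auto simp: X_def Y_def dest: prec_asym)
  have split: "subset_mean p E h = subset_mean p X (\<lambda>K. subset_mean p Y (\<lambda>B. h (K \<union> B)))" for h
    using subset_mean_Un[OF XY(3,4,2), of p h] unfolding XY(1)[symmetric] .
  define q where "q K = (of_bool (e \<in> candidates K \<and> Q K) :: real)" for K
  define r where "r K B = (of_bool (\<forall>g\<in>Y - B. avail (K \<union> B) g \<longrightarrow> g \<inter> S = {}) :: real)" for K B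
  have cand: "e \<in> candidates (K \<union> B) \<longleftrightarrow> e \<in> candidates K" if "K \<subseteq> X" "B \<subseteq> Y" for K B
    using that by (intro candidates_cong) (auto simp: X_def Y_def dest: prec_asym)
  have Q': "Q (K \<union> B) \<longleftrightarrow> Q K" if "K \<subseteq> X" "B \<subseteq> Y" for K B
  proof -
    have "{f \<in> K \<union> B. f = e \<or> f \<lhd> e} = K"
      using that by (auto simp: X_def Y_def dest: prec_asym)
    moreover have "K \<union> B \<subseteq> E" using that by (auto simp: X_def Y_def)
    ultimately show ?thesis using Q[of "K \<union> B"] by simp
  qed
  have later: "{g \<in> candidates (K \<union> B). e \<lhd> g} = {g \<in> Y - B. avail (K \<union> B) g}"
    if "K \<subseteq> X" "B \<subseteq> Y" for K B
    using that by (auto simp: candidates_def X_def Y_def dest: prec_asym)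
  have "subset_mean p E (\<lambda>A. of_bool (e \<in> candidates A \<and> Q A)) =
      subset_mean p X (\<lambda>K. subset_mean p Y (\<lambda>B. q K))"
    unfolding split by (intro subset_mean_cong) (simp add: cand Q' q_def)
  also have "\<dots> = subset_mean p X q"
    using XY by simp
  finally have lhs: "subset_mean p E (\<lambda>A. of_bool (e \<in> candidates A \<and> Q A)) = subset_mean p X q" .
  have rhs: "subset_mean p E (\<lambda>A. of_bool (e \<in> candidates A \<and> Q A \<and>
      (\<forall>g\<in>candidates A. e \<lhd> g \<longrightarrow> g \<inter> S = {}))) =
      subset_mean p X (\<lambda>K. q K * subset_mean p Y (r K))"
    unfolding split subset_mean_cmult[symmetric]
  proof (intro subset_mean_cong)
    fix K B assume KB: "K \<subseteq> X" "B \<subseteq> Y"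
    have "(\<forall>g\<in>candidates (K \<union> B). e \<lhd> g \<longrightarrow> g \<inter> S = {}) \<longleftrightarrow>
        (\<forall>g\<in>Y - B. avail (K \<union> B) g \<longrightarrow> g \<inter> S = {})"
      using later[OF KB] by blast
    then show "of_bool (e \<in> candidates (K \<union> B) \<and> Q (K \<union> B) \<and>
        (\<forall>g\<in>candidates (K \<union> B). e \<lhd> g \<longrightarrow> g \<inter> S = {})) = q K * r K B"
      by (simp add: cand[OF KB] Q'[OF KB] q_def r_def flip: of_bool_conj)
  qed
  have "p ^ card S * subset_mean p X q = subset_mean p X (\<lambda>K. p ^ card S * q K)"
    by (simp add: subset_mean_cmult)
  also have "\<dots> \<le> subset_mean p X (\<lambda>K. q K * subset_mean p Y (r K))"
  proof (rule subset_mean_mono[OF p])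
    fix K assume K: "K \<subseteq> X"
    have "p ^ card (S - \<Union>(greedy w tie K)) \<le> subset_mean p Y (r K)"
      unfolding r_def
      using mean_no_later_candidate[OF p S by_weight(2)[OF XY(5)], of K] K
      unfolding by_weight(1)[OF XY(5)] by (force simp: X_def Y_def intro: prec_trans)
    \<comment> \<open>Vertices of \<open>S\<close> already covered by the greedy matching of
      \<open>K\<close> only lower the exponent.\<close>
    moreover have "p ^ card S \<le> p ^ card (S - \<Union>(greedy w tie K))"
      using p S by (intro power_decreasing card_mono) auto
    ultimately have "p ^ card S \<le> subset_mean p Y (r K)" by linarith
    then show "p ^ card S * q K \<le> q K * subset_mean p Y (r K)"
      by (simp add: q_def)
  qed
  finally show ?thesis unfolding lhs rhs .
qed

section \<open>Expected weights of classes of candidates\<close>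

lemma lasts_eq_iff: "lasts C e = e \<longleftrightarrow> (\<forall>g\<in>C. e \<lhd> g \<longrightarrow> g \<inter> e = {})"
  by (auto simp: lasts_def)

lemma mean_candidates_sum:
  "subset_mean p E (\<lambda>A. \<Sum>e\<in>candidates A. w e * h A e) =
   (\<Sum>e\<in>E. w e * subset_mean p E (\<lambda>A. of_bool (e \<in> candidates A) * h A e))"
proof -
  have "(\<Sum>e\<in>candidates A. w e * h A e) = (\<Sum>e\<in>E. w e * (of_bool (e \<in> candidates A) * h A e))" for A
    using finite_E by (intro sum.mono_neutral_cong_left) (auto simp: candidates_def)
  then show ?thesis
    by (simp add: subset_mean_sum subset_mean_cmult)
qed

lemma sum_candidates_filter:
  "sum w {e \<in> candidates A. P e} = (\<Sum>e\<in>candidates A. w e * of_bool (P e))"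
proof -
  have "finite (candidates A)" using finite_E by (auto simp: candidates_def)
  then show ?thesis
    by (simp add: sum_filter_of_bool)
qed

lemma mean_candidates_filter:
  "subset_mean p E (\<lambda>A. sum w {e \<in> candidates A. P A e}) =
   (\<Sum>e\<in>E. w e * subset_mean p E (\<lambda>A. of_bool (e \<in> candidates A \<and> P A e)))"
  unfolding sum_candidates_filter mean_candidates_sum by (simp add: of_bool_conj)

lemma mean_lasts_ge:
  assumes "0 \<le> p" "p \<le> 1"
  shows "p\<^sup>2 * subset_mean p E (\<lambda>A. sum w (candidates A)) \<le>
    subset_mean p E (\<lambda>A. sum w {e \<in> candidates A. lasts (candidates A) e = e})"
proof -
  have "p\<^sup>2 * subset_mean p E (\<lambda>A. sum w (candidates A)) =
      (\<Sum>e\<in>E. w e * (p\<^sup>2 * subset_mean p E (\<lambda>A. of_bool (e \<in> candidates A))))"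
    using mean_candidates_filter[of p "\<lambda>_ _. True"] by (simp add: sum_distrib_left mult_ac)
  also have "\<dots> \<le> (\<Sum>e\<in>E. w e *
      subset_mean p E (\<lambda>A. of_bool (e \<in> candidates A \<and> lasts (candidates A) e = e)))"
  proof (intro sum_mono mult_left_mono weight_nonneg)
    fix e assume e: "e \<in> E"
    then show "p\<^sup>2 * subset_mean p E (\<lambda>A. of_bool (e \<in> candidates A)) \<le>
      subset_mean p E (\<lambda>A. of_bool (e \<in> candidates A \<and> lasts (candidates A) e = e))"
      unfolding lasts_eq_iff
      using candidate_without_later[OF assms e finite_edge[OF e], of "\<lambda>_. True"] card_edge[OF e]
      by simp
  qed
  finally show ?thesis unfolding mean_candidates_filter .
qed

lemma mean_isolated_ge:
  assumes "0 \<le> p" "p \<le> 1"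
  shows "p\<^sup>2 * subset_mean p E (\<lambda>A. sum w {e \<in> candidates A. firsts (candidates A) e = e}) \<le>
    subset_mean p E (\<lambda>A. sum w {e \<in> candidates A.
      firsts (candidates A) e = e \<and> lasts (candidates A) e = e})"
proof -
  have "p\<^sup>2 * subset_mean p E (\<lambda>A. sum w {e \<in> candidates A. firsts (candidates A) e = e}) =
      (\<Sum>e\<in>E. w e * (p\<^sup>2 *
        subset_mean p E (\<lambda>A. of_bool (e \<in> candidates A \<and> firsts (candidates A) e = e))))"
    unfolding mean_candidates_filter by (simp add: sum_distrib_left mult_ac)
  also have "\<dots> \<le> (\<Sum>e\<in>E. w e * subset_mean p E (\<lambda>A. of_bool (e \<in> candidates A \<and>
        firsts (candidates A) e = e \<and> lasts (candidates A) e = e)))"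
  proof (intro sum_mono mult_left_mono weight_nonneg)
    fix e assume e: "e \<in> E"
    \<comment> \<open>Being first is decided by the predecessors of \<open>e\<close>, so it
      qualifies as the event \<open>Q\<close>.\<close>
    have "firsts (candidates A) e = e \<longleftrightarrow>
        firsts (candidates {f \<in> A. f = e \<or> f \<lhd> e}) e = e" if A: "A \<subseteq> E" for A
    proof -
      have "g \<in> candidates A \<longleftrightarrow> g \<in> candidates {f \<in> A. f = e \<or> f \<lhd> e}" if "g \<lhd> e" for g
        using A that by (intro candidates_cong) (auto dest: prec_trans)
      then show ?thesis unfolding firsts_def by blast
    qed
    from candidate_without_later[OF assms e finite_edge[OF e], of "\<lambda>A. firsts (candidates A) e = e", OF this]
    show "p\<^sup>2 * subset_mean p E (\<lambda>A. of_bool (e \<in> candidates A \<and> firsts (candidates A) e = e)) \<le>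
      subset_mean p E (\<lambda>A. of_bool (e \<in> candidates A \<and>
        firsts (candidates A) e = e \<and> lasts (candidates A) e = e))"
      unfolding lasts_eq_iff using card_edge[OF e] by simp
  qed
  finally show ?thesis unfolding mean_candidates_filter .
qed

text \<open>Apply \<open>candidate_without_later\<close> to each endpoint alone: a candidate is last
  there with conditional probability at least \<open>p\<close>, so linearity gives at least
  \<open>2 * p\<close> endpoints on average.\<close>

lemma mean_card_lasts_ge:
  assumes "0 \<le> p" "p \<le> 1"
  shows "(2 * p - 1) * subset_mean p E (\<lambda>A. sum w (candidates A)) \<le>
    subset_mean p E (\<lambda>A. \<Sum>e\<in>candidates A. w e * (real (card (lasts (candidates A) e)) - 1))"
proof -
  have "(2 * p - 1) * subset_mean p E (\<lambda>A. sum w (candidates A)) =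
      (\<Sum>e\<in>E. w e * ((2 * p - 1) * subset_mean p E (\<lambda>A. of_bool (e \<in> candidates A))))"
    using mean_candidates_filter[of p "\<lambda>_ _. True"] by (simp add: sum_distrib_left mult_ac)
  also have "\<dots> \<le> (\<Sum>e\<in>E. w e * subset_mean p E (\<lambda>A. of_bool (e \<in> candidates A) *
      (real (card (lasts (candidates A) e)) - 1)))"
  proof (intro sum_mono mult_left_mono weight_nonneg)
    fix e assume e: "e \<in> E"
    let ?c = "subset_mean p E (\<lambda>A. of_bool (e \<in> candidates A))"
    have fin: "finite e" using e by (rule finite_edge)
    have card: "real (card (lasts C e)) = (\<Sum>u\<in>e. of_bool (u \<in> lasts C e))" for C
    proof -
      have "lasts C e = {u \<in> e. u \<in> lasts C e}" by (auto simp: lasts_def)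
      then have "real (card (lasts C e)) = (\<Sum>u\<in>{u \<in> e. u \<in> lasts C e}. 1)" by simp
      also have "\<dots> = (\<Sum>u\<in>e. of_bool (u \<in> lasts C e))"
        using fin by (simp only: sum.inter_filter of_bool_def)
      finally show ?thesis .
    qed
    have "2 * p * ?c = (\<Sum>u\<in>e. p * ?c)" using card_edge[OF e] by simp
    also have "\<dots> \<le> (\<Sum>u\<in>e. subset_mean p E (\<lambda>A. of_bool (e \<in> candidates A) *
        of_bool (u \<in> lasts (candidates A) e)))"
    proof (rule sum_mono)
      fix u assume "u \<in> e"
      then have "u \<in> lasts C e \<longleftrightarrow> (\<forall>g\<in>C. e \<lhd> g \<longrightarrow> g \<inter> {u} = {})" for C
        by (auto simp: lasts_def)
      then show "p * ?c \<le> subset_mean p E (\<lambda>A. of_bool (e \<in> candidates A) *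
          of_bool (u \<in> lasts (candidates A) e))"
        using candidate_without_later[OF assms e, of "{u}" "\<lambda>_. True"]
        by (simp flip: of_bool_conj)
    qed
    also have "\<dots> = subset_mean p E (\<lambda>A. of_bool (e \<in> candidates A) *
        real (card (lasts (candidates A) e)))"
      by (simp only: card subset_mean_sum[symmetric] sum_distrib_left)
    finally show "(2 * p - 1) * ?c \<le> subset_mean p E (\<lambda>A. of_bool (e \<in> candidates A) *
        (real (card (lasts (candidates A) e)) - 1))"
      by (simp add: right_diff_distrib left_diff_distrib subset_mean_diff)
  qed
  finally show ?thesis unfolding mean_candidates_sum .
qed

subsection \<open>Comparison with the optimum\<close>

text \<open>For \<open>F = E\<close> this is the quantity \<open>Y\<close>; a matching
  \<open>L\<close> in place of \<open>F\<close> lets the edges of the optimum be treated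
  apart.\<close>

definition avail_weight :: "real \<Rightarrow> 'v set set \<Rightarrow> real" where
  "avail_weight p F = (\<Sum>e\<in>F. w e * subset_mean p E (\<lambda>A. of_bool (avail A e)))"

lemma avail_insert: "e \<in> E \<Longrightarrow> A \<subseteq> E \<Longrightarrow> avail (insert e A) e \<longleftrightarrow> avail A e"
  by (rule avail_cong) auto

text \<open>Availability of \<open>e\<close> is independent of the coin of \<open>e\<close>, which
  leaves it unsampled with probability \<open>1 - p\<close>.\<close>

lemma mean_candidates: "subset_mean p E (\<lambda>A. sum w (candidates A)) = (1 - p) * avail_weight p E"
proof -
  have "subset_mean p E (\<lambda>A. of_bool (e \<in> candidates A)) =
      (1 - p) * subset_mean p E (\<lambda>A. of_bool (avail A e))" if e: "e \<in> E" for e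
  proof -
    have "subset_mean p E (\<lambda>A. of_bool (e \<in> candidates A)) =
        subset_mean p E (\<lambda>A. of_bool (e \<notin> A) * of_bool (avail A e))"
      using e by (intro subset_mean_cong) (auto simp: candidates_def)
    then show ?thesis
      using subset_mean_indep(2)[OF finite_E e, of "\<lambda>A. of_bool (avail A e)" p] avail_insert[OF e]
      by (simp add: subset_iff)
  qed
  then show ?thesis
    using mean_candidates_filter[of p "\<lambda>_ _. True"]
    by (simp add: avail_weight_def sum_distrib_left mult_ac)
qed

text \<open>The mean of \<open>matching_le_greedy\<close>. Greedy edges are the sampled available
  ones, a fraction \<open>p\<close> of each availability; exempting those in \<open>L\<close>
  accounts for the \<open>- 2 * p\<close> in the factor of \<open>avail_weight p L\<close>.\<close>

lemma matching_le_avail_weight: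
  assumes "0 \<le> p" "p \<le> 1" "matching E L"
  shows "sum w L \<le> (1 - 2 * p) * avail_weight p L + 2 * p * avail_weight p E"
proof -
  have L: "L \<subseteq> E" "finite L" using assms finite_E by (auto simp: matching_def intro: finite_subset)
  have "sum w L = subset_mean p E (\<lambda>_. sum w L)" using finite_E by simp
  also have "\<dots> \<le> subset_mean p E (\<lambda>A. (\<Sum>e\<in>L. w e * of_bool (avail A e)) +
      2 * (\<Sum>e\<in>E - L. w e * (of_bool (e \<in> A) * of_bool (avail A e))))"
  proof (rule subset_mean_mono[OF assms(1,2)])
    fix A assume A: "A \<subseteq> E"
    have "sum w (greedy w tie A - L) = (\<Sum>e\<in>E - L. w e * (of_bool (e \<in> A) * of_bool (avail A e)))"
      using finite_E A by (intro sum.mono_neutral_cong_left) (auto simp: mem_greedy)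
    then show "sum w L \<le> (\<Sum>e\<in>L. w e * of_bool (avail A e)) +
        2 * (\<Sum>e\<in>E - L. w e * (of_bool (e \<in> A) * of_bool (avail A e)))"
      using matching_le_greedy[OF A assms(3)] by simp
  qed
  also have "\<dots> = avail_weight p L +
      2 * (\<Sum>e\<in>E - L. w e * subset_mean p E (\<lambda>A. of_bool (e \<in> A) * of_bool (avail A e)))"
    by (simp add: subset_mean_add subset_mean_cmult subset_mean_sum avail_weight_def)
  also have "(\<Sum>e\<in>E - L. w e * subset_mean p E (\<lambda>A. of_bool (e \<in> A) * of_bool (avail A e))) =
      p * avail_weight p (E - L)"
    unfolding avail_weight_def sum_distrib_left
  proof (rule sum.cong)
    fix e assume "e \<in> E - L"
    then have e: "e \<in> E" by simp
    show "w e * subset_mean p E (\<lambda>A. of_bool (e \<in> A) * of_bool (avail A e)) =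
        p * (w e * subset_mean p E (\<lambda>A. of_bool (avail A e)))"
      using subset_mean_indep(1)[OF finite_E e, of "\<lambda>A. of_bool (avail A e)" p] avail_insert[OF e]
      by (simp add: subset_iff)
  qed simp
  also have "avail_weight p (E - L) = avail_weight p E - avail_weight p L"
    unfolding avail_weight_def using finite_E L by (simp add: sum_diff)
  finally show ?thesis by (simp add: algebra_simps)
qed

lemma avail_weight_mono:
  assumes "0 \<le> p" "p \<le> 1" "L \<subseteq> E"
  shows "0 \<le> avail_weight p L" "avail_weight p L \<le> avail_weight p E"
proof -
  have "0 \<le> w e * subset_mean p E (\<lambda>A. of_bool (avail A e))" if "e \<in> E" for e
    using that assms weight_nonneg by (auto simp: subset_mean_def intro!: sum_nonneg mult_nonneg_nonneg)
  then show "0 \<le> avail_weight p L" "avail_weight p L \<le> avail_weight p E"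
    unfolding avail_weight_def using assms finite_E
    by (auto intro!: sum_nonneg sum_mono2)
qed

text \<open>In \<open>matching_le_avail_weight\<close> the sign of \<open>1 - 2 * p\<close> decides:
  if it is nonnegative, the optimal matching \<open>L\<close> is enlarged to \<open>E\<close>,
  otherwise its term is dropped.\<close>

lemma OPT_le_avail_weight:
  assumes "0 \<le> p" "p \<le> 1"
  shows "p \<le> 1 / 2 \<Longrightarrow> OPT E w \<le> avail_weight p E"
    and "1 / 2 \<le> p \<Longrightarrow> OPT E w \<le> 2 * p * avail_weight p E"
proof -
  have "{sum w M |M. matching E M} \<subseteq> sum w ` Pow E" by (auto simp: matching_def)
  then have "finite {sum w M |M. matching E M}"
    using finite_E by (meson finite_Pow_iff finite_imageI finite_subset)
  moreover have "matching E {}" by (simp add: matching_def)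
  ultimately have "OPT E w \<in> {sum w M |M. matching E M}"
    unfolding OPT_def by (intro Max_in) auto
  then obtain L where L: "matching E L" "OPT E w = sum w L" by auto
  then have "L \<subseteq> E" by (simp add: matching_def)
  note le = matching_le_avail_weight[OF assms L(1), folded L(2)] avail_weight_mono[OF assms this]
  show "OPT E w \<le> avail_weight p E" if "p \<le> 1 / 2"
    using le mult_left_mono[OF le(3), of "1 - 2 * p"] that by (simp add: algebra_simps)
  show "OPT E w \<le> 2 * p * avail_weight p E" if "1 / 2 \<le> p"
    using le mult_nonneg_nonneg[of "2 * p - 1" "avail_weight p L"] that by (simp add: algebra_simps)
qed

subsection \<open>The competitive ratio\<close>

text \<open>A bound valid for every maximal matching of the candidates holds whatever the adversary
  does, so only the mean over the sample remains.\<close>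

lemma expectation_greedy_based_ge:
  assumes "0 \<le> p" "p \<le> 1" "arrival_order E arr"
    and b: "\<And>A M. A \<subseteq> E \<Longrightarrow> maximal_matching (candidates A) M \<Longrightarrow> b A \<le> sum w M"
  shows "subset_mean p E b \<le> measure_pmf.expectation (greedy_based p E w tie arr) (sum w)"
proof -
  have p: "p \<in> {0..1}" using assms by simp
  have arr: "set_pmf (arr A) \<subseteq> permutations_of_set (E - A)" if "A \<subseteq> E" for A
    using assms that by (simp add: arrival_order_def)
  have fin: "finite (set_pmf (arr A))" if "A \<subseteq> E" for A
    by (rule finite_subset[OF arr[OF that]]) simp
  have "subset_mean p E b = measure_pmf.expectation (sample p E) b"
    using assms finite_E by (simp add: expectation_sample)
  also have "\<dots> = (\<Sum>A\<in>Pow E. pmf (sample p E) A *\<^sub>R b A)"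
    using finite_E finite_set_pmf_sample[OF finite_E p] by (intro integral_measure_pmf) auto
  also have "\<dots> \<le> (\<Sum>A\<in>Pow E. pmf (sample p E) A *\<^sub>R measure_pmf.expectation
      (arr A \<bind> (\<lambda>es. return_pmf (online_phase w tie A es))) (sum w))"
  proof (intro sum_mono scaleR_left_mono)
    fix A assume "A \<in> Pow E"
    then have A: "A \<subseteq> E" by simp
    let ?D = "arr A \<bind> (\<lambda>es. return_pmf (online_phase w tie A es))"
    have "finite (set_pmf ?D)" using fin[OF A] by simp
    moreover have "\<forall>M\<in>set_pmf ?D. b A \<le> sum w M"
      using arr[OF A] b[OF A online_phase_maximal[OF A]] by auto
    ultimately show "b A \<le> measure_pmf.expectation ?D (sum w)"
      by (intro measure_pmf.integral_ge_const integrable_measure_pmf_finite) (auto simp: AE_measure_pmf_iff)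
  qed simp
  also have "\<dots> = measure_pmf.expectation (greedy_based p E w tie arr) (sum w)"
    unfolding greedy_based_def using finite_E finite_set_pmf_sample[OF finite_E p] fin
    by (intro pmf_expectation_bind[symmetric]) auto
  finally show ?thesis .
qed

lemma expectation_greedy_based_bounds:
  assumes p: "0 \<le> p" "p \<le> 1" and arr: "arrival_order E arr"
  defines "W \<equiv> measure_pmf.expectation (greedy_based p E w tie arr) (sum w)"
    and "c \<equiv> subset_mean p E (\<lambda>A. sum w (candidates A))"
  shows "p\<^sup>2 / 2 * c \<le> W" "p ^ 3 * c \<le> W" "(2 * p - 1) * c \<le> W"
proof -
  have sub: "candidates A \<subseteq> E" for A by (auto simp: candidates_def)
  define d where "d = subset_mean p E (\<lambda>A. sum w {e \<in> candidates A. lasts (candidates A) e = e})"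
  define i where "i = subset_mean p E (\<lambda>A. sum w {e \<in> candidates A.
      firsts (candidates A) e = e \<and> lasts (candidates A) e = e})"
  define r where "r = subset_mean p E (\<lambda>A. sum w {e \<in> candidates A. firsts (candidates A) e = e})"
  have "subset_mean p E (\<lambda>A. 1 / 2 * (sum w {e \<in> candidates A. lasts (candidates A) e = e} +
      sum w {e \<in> candidates A. firsts (candidates A) e = e \<and> lasts (candidates A) e = e})) \<le> W"
    unfolding W_def
  proof (rule expectation_greedy_based_ge[OF p arr])
    fix A M assume "maximal_matching (candidates A) M"
    from sum_isolated_le[OF sub this]
    show "1 / 2 * (sum w {e \<in> candidates A. lasts (candidates A) e = e} +
      sum w {e \<in> candidates A. firsts (candidates A) e = e \<and> lasts (candidates A) e = e}) \<le> sum w M"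
      by simp
  qed
  then have W: "(d + i) / 2 \<le> W"
    unfolding subset_mean_cmult subset_mean_add d_def i_def by simp
  have d: "p\<^sup>2 * c \<le> d" and i: "p\<^sup>2 * r \<le> i"
    unfolding c_def d_def r_def i_def using mean_lasts_ge[OF p] mean_isolated_ge[OF p] by auto
  have "(2 * p - 1) * c \<le> r"
    unfolding c_def r_def using sum_card_lasts_le_roots[OF sub]
    by (intro order_trans[OF mean_card_lasts_ge[OF p] subset_mean_mono[OF p]])
  then have "p\<^sup>2 * ((2 * p - 1) * c) \<le> p\<^sup>2 * r"
    by (rule mult_left_mono) simp
  \<comment> \<open>The coefficients of \<open>d\<close> and \<open>i\<close> add up to
    \<open>p\<^sup>2 + p\<^sup>2 * (2 * p - 1) = 2 * p ^ 3\<close>, of which half remains.\<close>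
  then show "p ^ 3 * c \<le> W"
    using W d i by (simp add: algebra_simps power2_eq_square power3_eq_cube)
  have "0 \<le> r"
    unfolding r_def subset_mean_def using p weight_nonneg sub
    by (auto intro!: sum_nonneg mult_nonneg_nonneg)
  then have "0 \<le> i" using i by (intro order_trans[OF mult_nonneg_nonneg i]) auto
  then show "p\<^sup>2 / 2 * c \<le> W" using W d by simp
  show "(2 * p - 1) * c \<le> W"
    unfolding c_def W_def
    using sum_card_lasts_le_matching[OF sub]
    by (intro order_trans[OF mean_card_lasts_ge[OF p] expectation_greedy_based_ge[OF p arr]])
qed

end

theorem theorem5p8:
  fixes p :: real
    and V :: "'v set"
    and E :: "'v set set"
    and w :: "'v set \<Rightarrow> real"
    and tie :: "'v set \<Rightarrow> nat"
    and arr :: "'v set set \<Rightarrow> 'v set list pmf"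
  assumes "0 \<le> p" and "p \<le> 1"
    and "finite_graph V E"
    and "\<And>e. e \<in> E \<Longrightarrow> w e \<ge> 0"
    and "inj_on tie E"
    and "arrival_order E arr"
  shows "measure_pmf.expectation (greedy_based p E w tie arr) (\<lambda>M. \<Sum>e\<in>M. w e)
           \<ge> ratio p * OPT E w"
proof -
  have "E \<subseteq> Pow V" "finite V" using assms(3) by (auto simp: finite_graph_def)
  then have "finite E" by (meson finite_Pow_iff finite_subset)
  then interpret weighted_edges E w tie
    by unfold_locales (use assms in \<open>auto simp: finite_graph_def\<close>)
  let ?W = "measure_pmf.expectation (greedy_based p E w tie arr) (sum w)"
  let ?Y = "avail_weight p E"
  note bounds = expectation_greedy_based_bounds[OF assms(1,2,6), unfolded mean_candidates]
  have golden: "1 / 2 < (sqrt 5 - 1) / 2"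
    using real_less_rsqrt[of 2 5] by simp
  \<comment> \<open>At \<open>1 / 2\<close> the comparison with the optimum changes; at
    \<open>(sqrt 5 - 1) / 2\<close>, a root of \<open>p ^ 3 = 2 * p - 1\<close>, the last two bounds
    agree.\<close>
  consider "p \<le> 1 / 2" | "1 / 2 < p" "p \<le> (sqrt 5 - 1) / 2" | "(sqrt 5 - 1) / 2 < p" by linarith
  then have "ratio p * OPT E w \<le> ?W"
  proof cases
    case 1
    then have "p\<^sup>2 * (1 - p) / 2 * OPT E w \<le> p\<^sup>2 * (1 - p) / 2 * ?Y"
      using assms OPT_le_avail_weight(1)[OF assms(1,2)] by (intro mult_left_mono) auto
    then show ?thesis using 1 golden bounds(1) by (simp add: ratio_def)
  next
    case 2
    \<comment> \<open>The loss of \<open>1 / (2 * p)\<close> against the optimum is made up by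
      \<open>p ^ 3 = 2 * p * (p\<^sup>2 / 2)\<close>.\<close>
    then have "p\<^sup>2 * (1 - p) / 2 * OPT E w \<le> p\<^sup>2 * (1 - p) / 2 * (2 * p * ?Y)"
      using assms OPT_le_avail_weight(2)[OF assms(1,2)] by (intro mult_left_mono) auto
    also have "\<dots> = p ^ 3 * ((1 - p) * ?Y)"
      by (simp add: power2_eq_square power3_eq_cube)
    finally show ?thesis using 2 bounds(2) by (simp add: ratio_def)
  next
    case 3
    then have p: "1 / 2 < p" using golden by simp
    then have "(1 - p) * (2 * p - 1) / (2 * p) * OPT E w \<le> (1 - p) * (2 * p - 1) / (2 * p) * (2 * p * ?Y)"
      using assms OPT_le_avail_weight(2)[OF assms(1,2)] by (intro mult_left_mono) auto
    also have "\<dots> = (2 * p - 1) * ((1 - p) * ?Y)"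
      using p by simp
    finally show ?thesis using 3 bounds(3) by (simp add: ratio_def)
  qed
  then show ?thesis by simp
qed

end
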